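(* Let $K$ be an algebraically closed field and $m\geq 4$. If $\operatorname{char}(K)=0$ then $$\mathbb{O}(m)=\{1,\ldots,m-1\}\setminus\mathbb{B}(m).$$ If $\operatorname{char}(K)=p>0$ then $$\mathbb{O}(m)=\{l\mid 1\leq l\leq m-1,\ p\nmid l\}\setminus\mathbb{B}(m)=\{l_p\mid l\in\{1,\ldots,m-1\}\setminus\mathbb{B}(m)\}.$$
   Context: $\mathcal{A}(m)$ is the set of all $K$-subalgebras $A$ of $K[x]$ such that $x^mK[x]\subset A$ and $x^{m-1}\notin A$. $\operatorname{Aut}_K(A)$ is the group of $K$-algebra automorphisms of $A$. $\mathbb{O}(m):=\{|\operatorname{Aut}_K(A)|\ :\ A\in\mathcal{A}(m),\ |\operatorname{Aut}_K(A)|<\infty\}$. $\mathbb{S}(m)$ is the set consisting of the empty set and of all non-empty subsets $\Gamma\subseteq\{2,\ldots,m-2\}$ such that $\Gamma+\Gamma\subseteq\Gamma\cup[m,\infty)$. $\mathbb{B}(m):=\{l\mid 1\leq l\leq m-1,\ l+\Gamma\subseteq\Gamma\cup[m,\infty)\text{ for all }\Gamma\in\mathbb{S}(m)\}$. For a prime $p$ and an integer $l\geq 1$, $l_p$ is the $p$-co-prime divisor of $l$: $l=p^kl_p$ with $k\geq 0$ and $p\nmid l_p$. *)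

theory Defs
  imports
    "HOL-Computational_Algebra.Polynomial"
    "HOL-Computational_Algebra.Primes"
    "HOL-Algebra.Bij"
begin

text \<open>Throughout, the type \<open>'a\<close> plays the role of the field \<open>K\<close>, and \<open>'a poly\<close> that of \<open>K[x]\<close>.
  Subalgebras are unital.\<close>

definition is_subalgebra :: "'a::field poly set \<Rightarrow> bool" where
  "is_subalgebra A \<longleftrightarrow>
     1 \<in> A \<and>
     (\<forall>f\<in>A. \<forall>g\<in>A. f + g \<in> A) \<and>
     (\<forall>f\<in>A. \<forall>g\<in>A. f * g \<in> A) \<and>
     (\<forall>c. \<forall>f\<in>A. smult c f \<in> A)"

definition subalgebras :: "nat \<Rightarrow> 'a::field poly set set" where
  "subalgebras m =
     {A. is_subalgebra A \<and> range (\<lambda>f. monom 1 m * f) \<subseteq> A \<and> monom 1 (m - 1) \<notin> A}"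

text \<open>As for \<^const>\<open>Bij\<close>, the automorphisms are taken to be extensional functions, so that
  counting them is meaningful.\<close>

definition alg_auto :: "'a::field poly set \<Rightarrow> ('a poly \<Rightarrow> 'a poly) set" where
  "alg_auto A =
     {\<phi> \<in> Bij A.
        \<phi> 1 = 1 \<and>
        (\<forall>f\<in>A. \<forall>g\<in>A. \<phi> (f + g) = \<phi> f + \<phi> g) \<and>
        (\<forall>f\<in>A. \<forall>g\<in>A. \<phi> (f * g) = \<phi> f * \<phi> g) \<and>
        (\<forall>c. \<forall>f\<in>A. \<phi> (smult c f) = smult c (\<phi> f))}"

definition AutAlg :: "'a::field poly set \<Rightarrow> ('a poly \<Rightarrow> 'a poly) monoid" where
  "AutAlg A = BijGroup A \<lparr>carrier := alg_auto A\<rparr>"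

lemma group_AutAlg:
  assumes "is_subalgebra A"
  shows "group (AutAlg A)"
proof -
  interpret B: group "BijGroup A"
    by (rule group_BijGroup)
  have mult: "\<phi> \<otimes>\<^bsub>BijGroup A\<^esub> \<psi> = compose A \<phi> \<psi>" if "\<phi> \<in> Bij A" "\<psi> \<in> Bij A" for \<phi> \<psi>
    using that by (simp add: BijGroup_def)
  have "subgroup (alg_auto A) (BijGroup A)"
  proof
    show "alg_auto A \<subseteq> carrier (BijGroup A)"
      by (auto simp: alg_auto_def BijGroup_def)
  next
    fix \<phi> \<psi>
    assume \<phi>: "\<phi> \<in> alg_auto A" and \<psi>: "\<psi> \<in> alg_auto A"
    have B: "\<phi> \<in> Bij A" "\<psi> \<in> Bij A"
      using \<phi> \<psi> by (auto simp: alg_auto_def)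
    have "\<And>f. f \<in> A \<Longrightarrow> \<psi> f \<in> A"
      using B(2) Bij_imp_funcset by blast
    thus "\<phi> \<otimes>\<^bsub>BijGroup A\<^esub> \<psi> \<in> alg_auto A"
      using \<phi> \<psi> assms B compose_Bij[OF B]
      by (auto simp: mult alg_auto_def is_subalgebra_def compose_eq)
  next
    show "\<one>\<^bsub>BijGroup A\<^esub> \<in> alg_auto A"
      using assms id_Bij[of A] by (auto simp: BijGroup_def alg_auto_def is_subalgebra_def)
  next
    fix \<phi>
    assume \<phi>: "\<phi> \<in> alg_auto A"
    hence B: "\<phi> \<in> Bij A"
      by (simp add: alg_auto_def)
    define \<psi> where "\<psi> = (\<lambda>f\<in>A. inv_into A \<phi> f)"
    have "inv\<^bsub>BijGroup A\<^esub> \<phi> = \<psi>"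
      using inv_BijGroup[OF B] by (simp add: \<psi>_def)
    moreover have \<psi>B: "\<psi> \<in> Bij A"
      unfolding \<psi>_def by (rule restrict_inv_into_Bij[OF B])
    moreover have \<psi>A: "\<psi> f \<in> A" if "f \<in> A" for f
      using \<psi>B that Bij_imp_funcset by blast
    moreover have inv: "\<phi> (\<psi> f) = f" if "f \<in> A" for f
      using B that by (simp add: \<psi>_def Bij_def bij_betw_def f_inv_into_f)
    moreover have eqI: "\<psi> f = h" if "f \<in> A" "h \<in> A" "\<phi> h = f" for f h
      using B that by (auto simp: \<psi>_def Bij_def bij_betw_def intro: inv_into_f_eq)
    moreover have "\<psi> 1 = 1"
      using \<phi> assms by (intro eqI) (auto simp: alg_auto_def is_subalgebra_def)
    moreover have "\<psi> (f + g) = \<psi> f + \<psi> g" if "f \<in> A" "g \<in> A" for f g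
      using \<phi> assms that \<psi>A by (intro eqI) (auto simp: alg_auto_def is_subalgebra_def inv)
    moreover have "\<psi> (f * g) = \<psi> f * \<psi> g" if "f \<in> A" "g \<in> A" for f g
      using \<phi> assms that \<psi>A by (intro eqI) (auto simp: alg_auto_def is_subalgebra_def inv)
    moreover have "\<psi> (smult c f) = smult c (\<psi> f)" if "f \<in> A" for c f
      using \<phi> assms that \<psi>A by (intro eqI) (auto simp: alg_auto_def is_subalgebra_def inv)
    ultimately show "inv\<^bsub>BijGroup A\<^esub> \<phi> \<in> alg_auto A"
      by (simp add: alg_auto_def)
  qed
  thus ?thesis
    unfolding AutAlg_def by (rule subgroup.subgroup_is_group) (rule group_BijGroup)
qed

text \<open>The explicit type argument is needed because the field \<open>K\<close> does not show in the type
  of the resulting set.\<close>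

definition aut_orders :: "'a::field itself \<Rightarrow> nat \<Rightarrow> nat set" where
  "aut_orders _ m =
     {card (carrier (AutAlg A)) | A :: 'a poly set. A \<in> subalgebras m \<and> finite (carrier (AutAlg A))}"

definition S_set :: "nat \<Rightarrow> nat set set" where
  "S_set m =
     {{}} \<union> {\<Gamma>. \<Gamma> \<noteq> {} \<and> \<Gamma> \<subseteq> {2..m-2} \<and> {a + b | a b. a \<in> \<Gamma> \<and> b \<in> \<Gamma>} \<subseteq> \<Gamma> \<union> {m..}}"

definition B_set :: "nat \<Rightarrow> nat set" where
  "B_set m = {l. 1 \<le> l \<and> l \<le> m - 1 \<and> (\<forall>\<Gamma>\<in>S_set m. (+) l ` \<Gamma> \<subseteq> \<Gamma> \<union> {m..})}"

definition coprime_part :: "nat \<Rightarrow> nat \<Rightarrow> nat" where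
  "coprime_part p l = l div p ^ multiplicity p l"

lemma coprime_part_iff:
  assumes "prime p" "l \<ge> 1"
  shows "coprime_part p l = q \<longleftrightarrow> (\<exists>k. l = p ^ k * q) \<and> \<not> p dvd q"
proof
  have nu: "\<not> is_unit p"
    using assms not_prime_unit by blast
  show "(\<exists>k. l = p ^ k * q) \<and> \<not> p dvd q" if "coprime_part p l = q"
    using that assms nu multiplicity_decompose[of l p]
    by (auto simp: coprime_part_def multiplicity_dvd intro!: exI[of _ "multiplicity p l"])
  show "coprime_part p l = q" if *: "(\<exists>k. l = p ^ k * q) \<and> \<not> p dvd q"
  proof -
    from * obtain k where k: "l = p ^ k * q" "\<not> p dvd q"
      by blast
    hence "multiplicity p l = k"
      using assms by (intro multiplicity_eqI) (auto simp: mult.commute)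
    thus ?thesis
      using k assms prime_gt_0_nat[of p] by (simp add: coprime_part_def)
  qed
qed

end

theory Submission
  imports Defs
begin

text \<open>An automorphism of \<open>A\<close> extends to \<open>K[x]\<close> and preserves the conductor \<open>x\<^sup>m K[x]\<close>, hence is a
  dilation \<open>x \<mapsto> c x\<close>. In terms of the reduced basis
  \<open>F\<^sub>k = x\<^sup>k + \<dots>\<close> of \<open>A\<close>, where \<open>k\<close> ranges over the set of orders at \<open>0\<close> of elements of \<open>A\<close> and no other
  order occurs as an exponent in \<open>F\<^sub>k\<close>, the dilation by \<open>c\<close> preserves \<open>A\<close> iff \<open>c\<^bsup>i-k\<^esup> = 1\<close> whenever
  \<open>x\<^sup>i\<close> occurs in \<open>F\<^sub>k\<close>. So the group is that of the \<open>d\<close>-th roots of unity, \<open>d\<close> being the gcd of the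
  \<open>i - k\<close>. As each such \<open>i\<close> is not an order and less than \<open>m\<close>, every divisor of \<open>i - k\<close>, such as
  the number of \<open>d\<close>-th roots of unity, lies outside \<open>B(m)\<close>. Conversely, \<open>\<Gamma> \<in> S(m)\<close> and the largest
  \<open>a \<in> \<Gamma>\<close> with \<open>a + l \<notin> \<Gamma> \<union> [m,\<infinity>)\<close> give an algebra
  containing \<open>x\<^sup>a + x\<^bsup>a+l\<^esup>\<close> whose only other basis elements are monomials; its group consists of
  the \<open>l\<close>-th roots of unity.\<close>

section \<open>Divisibility and roots of unity over algebraically closed fields\<close>

text \<open>A root \<open>a\<close> of \<open>u\<close> is also a root of \<open>v\<close>;
  cancelling \<open>[:-a, 1:] ^ n\<close> lowers the degree of \<open>u\<close>.\<close>

lemma power_dvd_power_imp_dvd: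
  fixes u v :: "'a::alg_closed_field poly"
  assumes "u ^ n dvd v ^ n" "n > 0"
  shows "u dvd v"
  using assms(1)
proof (induction "degree u" arbitrary: u v)
  case 0
  show ?case
  proof (cases "u = 0")
    case True
    with 0 \<open>n > 0\<close> show ?thesis by (simp add: power_0_left)
  next
    case False
    with 0 have "is_unit u" by (simp add: is_unit_iff_degree)
    thus ?thesis by blast
  qed
next
  case (Suc d)
  obtain a where a: "poly u a = 0"
    using alg_closed_imp_poly_has_root[of u] Suc.hyps by auto
  then obtain u' where u': "u = [:-a, 1:] * u'"
    by (auto simp: poly_eq_0_iff_dvd)
  have "poly (v ^ n) a = 0"
    using Suc.prems a \<open>n > 0\<close> by (auto elim!: dvdE simp del: poly_power) (simp add: poly_power power_0_left)
  hence "poly v a = 0" by simp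
  then obtain v' where v': "v = [:-a, 1:] * v'"
    by (auto simp: poly_eq_0_iff_dvd)
  have "u' \<noteq> 0" using Suc.hyps u' by auto
  hence "degree u = Suc (degree u')"
    using u' by (subst u', subst degree_mult_eq) auto
  moreover have "[:-a, 1:] ^ n * u' ^ n dvd [:-a, 1:] ^ n * v' ^ n"
    using Suc.prems by (simp only: u' v' power_mult_distrib)
  hence "u' ^ n dvd v' ^ n"
    by (subst (asm) dvd_mult_cancel_left) auto
  ultimately have "u' dvd v'"
    using Suc.hyps by auto
  thus ?case by (simp only: u' v' mult_dvd_mono dvd_refl)
qed

text \<open>All roots are simple, so splitting off the factor at \<open>a\<close> leaves a cofactor
  that does not vanish at \<open>a\<close> and has only simple roots: each degree accounts for one
  new root.\<close>

lemma card_roots_separable: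
  fixes f :: "'a::alg_closed_field poly"
  assumes "f \<noteq> 0" "\<And>a. poly f a = 0 \<Longrightarrow> poly (pderiv f) a \<noteq> 0"
  shows "card {a. poly f a = 0} = degree f"
  using assms
proof (induction "degree f" arbitrary: f)
  case 0
  then obtain c where "f = [:c:]" by (metis degree_eq_zeroE)
  with 0 show ?case by simp
next
  case (Suc d)
  obtain a where a: "poly f a = 0"
    using alg_closed_imp_poly_has_root[of f] Suc.hyps by auto
  then obtain g where g: "f = [:-a, 1:] * g"
    by (auto simp: poly_eq_0_iff_dvd)
  have "g \<noteq> 0" using Suc.prems g by auto
  have deg: "degree f = Suc (degree g)"
    using \<open>g \<noteq> 0\<close> by (subst g, subst degree_mult_eq) auto
  have df: "poly (pderiv f) b = poly g b + (b - a) * poly (pderiv g) b" for b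
    unfolding g pderiv_mult by (simp add: pderiv_pCons algebra_simps)
  have pg: "poly (pderiv g) b \<noteq> 0" if "poly g b = 0" for b
    using Suc.prems(2)[of b] df[of b] that g by auto
  have "poly g a \<noteq> 0" using Suc.prems(2)[OF a] df[of a] by simp
  moreover have "card {b. poly g b = 0} = degree g"
    using \<open>g \<noteq> 0\<close> deg Suc.hyps(2) pg by (intro Suc.hyps(1)) auto
  moreover have "{b. poly f b = 0} = insert a {b. poly g b = 0}"
    by (auto simp: g)
  moreover have "finite {b. poly g b = 0}" using \<open>g \<noteq> 0\<close> by (rule poly_roots_finite)
  ultimately show ?case using deg by simp
qed

text \<open>The derivative of \<open>x^l - 1\<close> is \<open>l x^(l-1)\<close> with
  \<open>l\<close> nonzero in the field, so it vanishes at most at 0, which is not a root.\<close>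

lemma card_roots_of_unity:
  assumes "l > 0" "\<not> CHAR('a::alg_closed_field) dvd l"
  shows "card {c :: 'a. c ^ l = 1} = l"
proof -
  define f :: "'a poly" where "f = monom 1 l - 1"
  have p: "poly f c = c ^ l - 1" for c
    by (simp add: f_def poly_monom)
  have "f = [:-1:] + monom 1 l" by (simp add: f_def one_pCons)
  hence deg: "degree f = l"
    using \<open>l > 0\<close> by (simp only:) (subst degree_add_eq_right; simp add: degree_monom_eq)
  have "of_nat l \<noteq> (0 :: 'a)" using assms by (simp add: of_nat_eq_0_iff_char_dvd)
  hence "poly (pderiv f) c \<noteq> 0" if "poly f c = 0" for c
    using that \<open>l > 0\<close> by (auto simp: f_def pderiv_diff pderiv_monom poly_monom power_0_left)
  moreover have "f \<noteq> 0" using deg \<open>l > 0\<close> by auto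
  ultimately have "card {c. poly f c = 0} = l"
    using card_roots_separable[of f] deg by blast
  thus ?thesis by (simp add: p)
qed

text \<open>In characteristic \<open>p\<close>, Frobenius gives
  \<open>c^(p^k q) - 1 = (c^q - 1)^(p^k)\<close>, so the \<open>p\<close>-part of the exponent
  contributes no further roots.\<close>

lemma roots_of_unity_coprime_part:
  assumes "d > 0"
  obtains l where "l dvd d" "\<not> CHAR('a::field) dvd l" "{c :: 'a. c ^ d = 1} = {c. c ^ l = 1}"
proof (cases "CHAR('a) = 0")
  case True
  with assms show ?thesis by (intro that[of d]) auto
next
  case False
  define p where "p = CHAR('a)"
  have p: "prime p" using False prime_CHAR_semidom[where ?'a = 'a] by (simp add: p_def)
  obtain q where q: "d = p ^ multiplicity p d * q" "\<not> p dvd q"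
    using multiplicity_decompose'[of d p] p assms by (metis gr_implies_not0 not_prime_unit mult.commute)
  define k where "k = multiplicity p d"
  have dk: "d = p ^ k * q" using q k_def by simp
  have "c ^ d = 1 \<longleftrightarrow> c ^ q = 1" for c :: 'a
  proof
    assume "c ^ d = 1"
    hence 1: "(c ^ q) ^ (p ^ k) = 1" by (simp add: dk power_mult [symmetric] mult.commute)
    have "((c ^ q - 1) + 1) ^ (p ^ k) = (c ^ q - 1) ^ (p ^ k) + 1 ^ (p ^ k)"
      using p by (intro freshmans_dream') (auto simp: p_def)
    hence "(c ^ q - 1) ^ (p ^ k) = 0" using 1 by simp
    thus "c ^ q = 1" by simp
  next
    assume "c ^ q = 1"
    thus "c ^ d = 1" by (metis dk mult.commute power_mult power_one)
  qed
  with q dk show ?thesis by (intro that[of q]) (auto simp: p_def)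
qed

lemma power_Gcd_eq_1:
  fixes c :: "'a::field"
  assumes "finite D" "\<And>n. n \<in> D \<Longrightarrow> c ^ n = 1"
  shows "c ^ Gcd D = 1"
  using assms
proof (induction D rule: finite_induct)
  case (insert a D)
  define b where "b = Gcd D"
  have cb: "c ^ b = 1" and ca: "c ^ a = 1" using insert b_def by auto
  show ?case
  \<comment> \<open>Bezout with natural coefficients requires \<open>a\<close> to be
    nonzero.\<close>
  proof (cases "a = 0")
    case False
    then obtain x y where "a * x = b * y + gcd a b" using bezout_nat by blast
    hence "(c ^ a) ^ x = (c ^ b) ^ y * c ^ gcd a b" by (simp flip: power_mult power_add)
    thus ?thesis using ca cb by (simp add: b_def)
  qed (use cb b_def in auto)
qed simp

text \<open>Over a finite field, the product of all linear factors plus 1 would be a nonconstant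
  polynomial without a root.\<close>

lemma infinite_nonzero_alg_closed: "infinite {c :: 'a::alg_closed_field. c \<noteq> 0}"
proof
  assume fin: "finite {c :: 'a. c \<noteq> 0}"
  define f :: "'a poly" where "f = [:0, 1:] * (\<Prod>c\<in>{c. c \<noteq> 0}. [:-c, 1:])"
  have "f \<noteq> 0" using fin by (simp add: f_def del: mult_pCons_left)
  have "degree f = Suc (\<Sum>c\<in>{c :: 'a. c \<noteq> 0}. 1)"
    using fin unfolding f_def
    by (subst degree_mult_eq) (simp_all add: degree_prod_sum_eq del: mult_pCons_left)
  hence "degree (f + [:1:]) > 0"
    by (subst degree_add_eq_left) auto
  then obtain x where "poly (f + [:1:]) x = 0" using alg_closed_imp_poly_has_root by blast
  moreover have "poly f x = 0"
    using fin by (cases "x = 0") (auto simp: f_def poly_prod)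
  ultimately show False by simp
qed

lemma lowest_coeff_exists:
  assumes "f \<noteq> (0 :: 'a::zero poly)"
  shows "\<exists>n. coeff f n \<noteq> 0 \<and> (\<forall>j<n. coeff f j = 0)"
proof -
  have "\<exists>n. coeff f n \<noteq> 0" using assms by (auto simp: poly_eq_iff)
  thus ?thesis by (subst (asm) exists_least_iff) blast
qed

lemma pcompose_dilation_dilation:
  "c * d = 1 \<Longrightarrow> pcompose (pcompose f [:0, c:]) [:0, d:] = (f :: 'a::comm_ring_1 poly)"
  by (intro poly_eqI) (simp add: coeff_pcompose_linear flip: mult.assoc power_mult_distrib, simp add: mult.commute)

section \<open>The value semigroup and the reduced basis of a subalgebra\<close>

locale conductor_subalgebra =
  fixes A :: "'a::field poly set" and m :: nat
  assumes A: "A \<in> subalgebras m"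
begin

lemma one_mem: "1 \<in> A"
  and add_mem: "f \<in> A \<Longrightarrow> g \<in> A \<Longrightarrow> f + g \<in> A"
  and mult_mem: "f \<in> A \<Longrightarrow> g \<in> A \<Longrightarrow> f * g \<in> A"
  and smult_mem: "f \<in> A \<Longrightarrow> smult c f \<in> A"
  and monom_mult_mem: "monom 1 m * h \<in> A"
  and monom_notin: "monom 1 (m - 1) \<notin> A"
  using A by (auto simp: subalgebras_def is_subalgebra_def)

lemma zero_mem: "0 \<in> A"
  using smult_mem[OF one_mem, of 0] by simp

lemma diff_mem: "f - g \<in> A" if "f \<in> A" "g \<in> A"
  using add_mem[OF that(1) smult_mem[OF that(2), of "-1"]] by simp

lemma power_mem: "f \<in> A \<Longrightarrow> f ^ n \<in> A"
  by (induction n) (auto intro: one_mem mult_mem)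

lemma sum_mem: "(\<And>i. i \<in> I \<Longrightarrow> f i \<in> A) \<Longrightarrow> sum f I \<in> A"
  by (induction I rule: infinite_finite_induct) (auto intro: zero_mem add_mem)

lemma high_mem: "f \<in> A" if "\<And>i. i < m \<Longrightarrow> coeff f i = 0"
proof -
  have "monom 1 m dvd f" using that by (simp add: monom_1_dvd_iff')
  thus ?thesis using monom_mult_mem by (auto elim!: dvdE)
qed

lemma m_ge_2: "m \<ge> 2"
proof (rule ccontr)
  assume "\<not> m \<ge> 2"
  \<comment> \<open>Subtraction truncates, so for \<open>m = 0\<close> as for \<open>m = 1\<close>
    the excluded monomial is 1.\<close>
  hence "m - 1 = 0" by simp
  thus False using monom_notin one_mem by (simp add: monom_0 one_pCons)
qed

text \<open>The value semigroup of \<open>A\<close> at 0.\<close>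

definition ords :: "nat set" where
  "ords = {n. \<exists>f\<in>A. coeff f n \<noteq> 0 \<and> (\<forall>j<n. coeff f j = 0)}"

lemma high_ords: "n \<ge> m \<Longrightarrow> n \<in> ords"
  unfolding ords_def by (auto intro!: bexI[of _ "monom 1 n"] high_mem)

lemma zero_ords: "0 \<in> ords"
  using one_mem by (auto simp: ords_def intro!: bexI[of _ 1])

lemma add_ords:
  assumes "a \<in> ords" "b \<in> ords"
  shows "a + b \<in> ords"
proof -
  obtain f where f: "f \<in> A" "coeff f a \<noteq> 0" "\<And>j. j < a \<Longrightarrow> coeff f j = 0"
    using assms by (auto simp: ords_def)
  obtain g where g: "g \<in> A" "coeff g b \<noteq> 0" "\<And>j. j < b \<Longrightarrow> coeff g j = 0"
    using assms by (auto simp: ords_def)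
  have "monom 1 a dvd f" "monom 1 b dvd g" using f g by (auto simp: monom_1_dvd_iff')
  then obtain f' g' where fg: "f = monom 1 a * f'" "g = monom 1 b * g'" by (auto elim!: dvdE)
  hence "f * g = monom 1 (a + b) * (f' * g')" by (simp add: mult_monom algebra_simps)
  hence "coeff (f * g) n = (if n < a + b then 0 else coeff (f' * g') (n - (a + b)))" for n
    by (simp only: coeff_monom_mult) simp
  moreover have "coeff f' 0 \<noteq> 0" "coeff g' 0 \<noteq> 0"
    using f(2) g(2) by (auto simp: fg coeff_monom_mult)
  ultimately show ?thesis
    using mult_mem[OF f(1) g(1)] by (auto simp: ords_def coeff_mult_0 intro!: bexI[of _ "f * g"])
qed

lemma pred_notin_ords: "m - 1 \<notin> ords"
proof
  assume "m - 1 \<in> ords"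
  then obtain f where f: "f \<in> A" "coeff f (m - 1) \<noteq> 0" "\<And>j. j < m - 1 \<Longrightarrow> coeff f j = 0"
    by (auto simp: ords_def)
  define c where "c = coeff f (m - 1)"
  \<comment> \<open>Beyond its lowest term, \<open>f\<close> lies in the conductor.\<close>
  have "f - monom c (m - 1) \<in> A"
    using f(3) by (intro high_mem) (auto simp: c_def not_less)
  hence "smult (1 / c) (f - (f - monom c (m - 1))) \<in> A"
    using f(1) by (blast intro: smult_mem diff_mem)
  thus False using monom_notin f(2) by (simp add: smult_monom c_def)
qed

lemma one_notin_ords: "1 \<notin> ords"
proof
  assume "1 \<in> ords"
  hence "n \<in> ords" for n
    by (induction n) (use zero_ords add_ords[of _ 1] in auto)
  thus False using pred_notin_ords by blast
qed

lemma ords_S_set: "ords \<inter> {1..m-1} \<in> S_set m"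
proof -
  have "n \<in> {2..m-2}" if "n \<in> ords" "n \<in> {1..m-1}" for n
  proof -
    have "n \<noteq> m - 1" "n \<noteq> 1" using that pred_notin_ords one_notin_ords by auto
    with that show ?thesis by auto
  qed
  thus ?thesis using add_ords by (fastforce simp: S_set_def)
qed

text \<open>The lowest exponent of a nonzero element of \<open>A\<close> belongs to
  \<open>ords\<close>. This is the uniqueness principle behind all later comparisons of elements of
  \<open>A\<close>.\<close>

lemma eq_0_of_coeff_ords:
  assumes "f \<in> A" "\<And>i. i \<in> ords \<Longrightarrow> coeff f i = 0"
  shows "f = 0"
proof (rule ccontr)
  assume "f \<noteq> 0"
  then obtain n where "coeff f n \<noteq> 0" "\<forall>j<n. coeff f j = 0"
    using lowest_coeff_exists by blast
  thus False using assms by (auto simp: ords_def)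
qed

text \<open>Gaussian elimination from the lowest exponent upwards: a multiple of an element of order
  \<open>k\<close> clears the coefficient at \<open>k\<close> without disturbing lower ones.\<close>

lemma complement_exists: "\<exists>r. g - r \<in> A \<and> (\<forall>i\<in>ords. coeff r i = 0)"
proof -
  have "\<exists>f\<in>A. \<forall>i\<in>ords. i < k \<longrightarrow> coeff (g - f) i = 0" for k
  proof (induction k)
    case 0
    show ?case using zero_mem by blast
  next
    case (Suc k)
    then obtain f where f: "f \<in> A" "\<And>i. i \<in> ords \<Longrightarrow> i < k \<Longrightarrow> coeff (g - f) i = 0" by blast
    show ?case
    proof (cases "k \<in> ords")
      case False
      with f show ?thesis by (metis less_antisym)
    next
      case True
      then obtain h where h: "h \<in> A" "coeff h k \<noteq> 0" "\<And>j. j < k \<Longrightarrow> coeff h j = 0"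
        by (auto simp: ords_def)
      define f' where "f' = f + smult (coeff (g - f) k / coeff h k) h"
      have "f' \<in> A" unfolding f'_def by (intro add_mem smult_mem f h)
      moreover have "coeff (g - f') i = 0" if "i \<in> ords" "i < Suc k" for i
        using f(2)[of i] h that by (cases "i = k") (auto simp: f'_def)
      ultimately show ?thesis by blast
    qed
  qed
  then obtain f where f: "f \<in> A" "\<And>i. i \<in> ords \<Longrightarrow> i < m \<Longrightarrow> coeff (g - f) i = 0" by blast
  \<comment> \<open>Terms of degree at least \<open>m\<close> lie in \<open>A\<close>, so
    elimination can stop at \<open>m\<close>.\<close>
  define r where "r = poly_cutoff m (g - f)"
  have "(g - f) - r \<in> A" by (intro high_mem) (simp add: r_def coeff_poly_cutoff)
  hence "g - r \<in> A" using add_mem[OF f(1)] by force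
  moreover have "coeff r i = 0" if "i \<in> ords" for i
    using f(2)[OF that] by (simp add: r_def coeff_poly_cutoff)
  ultimately show ?thesis by blast
qed

definition reduced_basis :: "(nat \<Rightarrow> 'a poly) \<Rightarrow> bool" where
  "reduced_basis F \<longleftrightarrow> (\<forall>k\<in>ords. F k \<in> A \<and> (\<forall>i\<in>ords. coeff (F k) i = (if i = k then 1 else 0))
     \<and> (\<forall>i<k. coeff (F k) i = 0))"

lemma reduced_basis_exists: "\<exists>F. reduced_basis F"
proof -
  obtain R where R: "\<And>k. monom 1 k - R k \<in> A" "\<And>k i. i \<in> ords \<Longrightarrow> coeff (R k) i = 0"
    using choice[of "\<lambda>k r. monom 1 k - r \<in> A \<and> (\<forall>i\<in>ords. coeff r i = 0)"]
      complement_exists by blast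
  define F where "F k = monom 1 k - R k" for k
  have F: "F k \<in> A" "\<And>i. i \<in> ords \<Longrightarrow> coeff (F k) i = (if i = k then 1 else 0)" for k
    using R by (auto simp: F_def)
  \<comment> \<open>The lowest exponent of \<open>F k\<close> is in \<open>ords\<close>, and
    \<open>k\<close> is the only exponent of \<open>F k\<close> there.\<close>
  have "coeff (F k) i = 0" if "k \<in> ords" "i < k" for k i
  proof (rule ccontr)
    assume i: "coeff (F k) i \<noteq> 0"
    hence "F k \<noteq> 0" by auto
    then obtain n where n: "coeff (F k) n \<noteq> 0" "\<forall>j<n. coeff (F k) j = 0"
      using lowest_coeff_exists by blast
    hence "n \<in> ords" using F(1)[of k] unfolding ords_def by blast
    hence "n = k" using F(2)[of n k] n(1) by presburger
    with n(2) i that show False by blast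
  qed
  with F have "reduced_basis F" by (simp add: reduced_basis_def)
  thus ?thesis by blast
qed

lemma
  assumes "reduced_basis F" "k \<in> ords"
  shows reduced_basis_mem: "F k \<in> A"
    and reduced_basis_coeff: "i \<in> ords \<Longrightarrow> coeff (F k) i = (if i = k then 1 else 0)"
    and reduced_basis_below: "i < k \<Longrightarrow> coeff (F k) i = 0"
  using assms by (auto simp: reduced_basis_def)


lemma reduced_basis_expansion:
  assumes "reduced_basis F" "f \<in> A"
  shows "f = (\<Sum>k\<in>ords \<inter> {..degree f}. smult (coeff f k) (F k))"
proof -
  define g where "g = (\<Sum>k\<in>ords \<inter> {..degree f}. smult (coeff f k) (F k))"
  have "g \<in> A" unfolding g_def using assms by (intro sum_mem smult_mem) (auto simp: reduced_basis_def)
  have "coeff (f - g) i = 0" if "i \<in> ords" for i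
  proof -
    have "coeff g i = (\<Sum>k\<in>ords \<inter> {..degree f}. if i = k then coeff f k else 0)"
      unfolding g_def coeff_sum using assms that by (intro sum.cong) (auto simp: reduced_basis_def)
    also have "\<dots> = coeff f i"
      using that by (auto simp: not_le coeff_eq_0)
    finally show ?thesis by simp
  qed
  hence "f - g = 0" using assms \<open>g \<in> A\<close> by (intro eq_0_of_coeff_ords diff_mem)
  thus ?thesis unfolding g_def by (rule eq_iff_diff_eq_0[THEN iffD2])
qed

section \<open>Dilations that preserve the subalgebra\<close>

text \<open>These are differences of exponents within one basis element, not the gaps of the
  semigroup \<open>ords\<close>. For a reduced basis \<open>i > k\<close>, so the subtraction does
  not truncate.\<close>

definition gaps :: "(nat \<Rightarrow> 'a poly) \<Rightarrow> nat set" where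
  "gaps F = {i - k | i k. k \<in> ords \<and> i \<noteq> k \<and> coeff (F k) i \<noteq> 0}"

lemma gaps_witness:
  assumes "reduced_basis F" "n \<in> gaps F"
  shows "\<exists>k\<in>ords. k > 0 \<and> n > 0 \<and> k + n \<notin> ords \<and> k + n < m \<and> coeff (F k) (k + n) \<noteq> 0"
proof -
  from assms obtain i k where ik: "n = i - k" "k \<in> ords" "i \<noteq> k" "coeff (F k) i \<noteq> 0"
    unfolding gaps_def by blast
  have i: "i \<notin> ords" using reduced_basis_coeff[OF assms(1) ik(2), of i] ik by auto
  have ki: "i > k" using reduced_basis_below[OF assms(1) ik(2), of i] ik by (metis linorder_neqE_nat)
  \<comment> \<open>\<open>F 0\<close> is 1, since their difference has no exponent in
    \<open>ords\<close>; hence it yields no gap.\<close>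
  have "k \<noteq> 0"
  proof
    assume "k = 0"
    have "F k - 1 = 0"
      using reduced_basis_coeff[OF assms(1) ik(2)] reduced_basis_mem[OF assms(1) ik(2)]
      by (intro eq_0_of_coeff_ords diff_mem one_mem) (auto simp: \<open>k = 0\<close>)
    with ik ki show False by simp
  qed
  moreover have "i < m" using high_ords i not_le by blast
  moreover have "k + n = i" "n > 0" using ik ki by simp_all
  ultimately show ?thesis using ik(2,4) i by (intro bexI[of _ k]) simp_all
qed

lemma dilation_stable_iff:
  assumes F: "reduced_basis F" and "c \<noteq> 0"
  shows "(\<forall>f\<in>A. pcompose f [:0, c:] \<in> A) \<longleftrightarrow> (\<forall>n\<in>gaps F. c ^ n = 1)"
proof (intro iffI ballI)
  fix n assume st: "\<forall>f\<in>A. pcompose f [:0, c:] \<in> A" and n: "n \<in> gaps F"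
  obtain k where k: "k \<in> ords" "coeff (F k) (k + n) \<noteq> 0"
    using gaps_witness[OF F n] by blast
  \<comment> \<open>The multiple of \<open>F k\<close> cancels the coefficient at \<open>k\<close>,
    the only exponent of \<open>F k\<close> in \<open>ords\<close>, which forces
    \<open>h = 0\<close>.\<close>
  define h where "h = pcompose (F k) [:0, c:] - smult (c ^ k) (F k)"
  have "h = 0"
    using st reduced_basis_mem[OF F k(1)] reduced_basis_coeff[OF F k(1)] unfolding h_def
    by (intro eq_0_of_coeff_ords diff_mem smult_mem) (auto simp: coeff_pcompose_linear)
  hence "coeff h (k + n) = 0" by simp
  hence "c ^ (k + n) = c ^ k" using k by (simp add: h_def coeff_pcompose_linear algebra_simps)
  thus "c ^ n = 1" using \<open>c \<noteq> 0\<close> by (simp add: power_add)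
next
  fix f assume c: "\<forall>n\<in>gaps F. c ^ n = 1" and f: "f \<in> A"
  \<comment> \<open>Each \<open>F k\<close> is an eigenvector of the dilation, and these elements
    span \<open>A\<close>.\<close>
  have Fk: "pcompose (F k) [:0, c:] = smult (c ^ k) (F k)" if k: "k \<in> ords" for k
  proof (rule poly_eqI)
    fix i
    have "c ^ i = c ^ k" if "coeff (F k) i \<noteq> 0"
    proof (cases "i = k")
      case False
      hence "c ^ (i - k) = 1" using c k that by (auto simp: gaps_def)
      moreover have "k \<le> i" using reduced_basis_below[OF F k] that not_le by blast
      ultimately show ?thesis by (metis le_add_diff_inverse mult.right_neutral power_add)
    qed simp
    thus "coeff (pcompose (F k) [:0, c:]) i = coeff (smult (c ^ k) (F k)) i"
      by (cases "coeff (F k) i = 0") (auto simp: coeff_pcompose_linear)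
  qed
  have "pcompose f [:0, c:] = (\<Sum>k\<in>ords \<inter> {..degree f}. smult (coeff f k) (pcompose (F k) [:0, c:]))"
    by (subst (1) reduced_basis_expansion[OF F f]) (simp only: pcompose_sum pcompose_smult)
  also have "\<dots> \<in> A"
    by (intro sum_mem smult_mem) (simp add: Fk smult_mem reduced_basis_mem[OF F])
  finally show "pcompose f [:0, c:] \<in> A" .
qed

definition stab :: "'a set" where
  "stab = {c. c \<noteq> 0 \<and> (\<forall>f\<in>A. pcompose f [:0, c:] \<in> A)}"

lemma stab_gaps: "reduced_basis F \<Longrightarrow> stab = {c. c \<noteq> 0 \<and> (\<forall>n\<in>gaps F. c ^ n = 1)}"
  unfolding stab_def using dilation_stable_iff by blast

text \<open>Membership in \<open>stab\<close> only says that \<open>A\<close> is mapped into itself;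
  the description by equations \<open>c ^ n = 1\<close> is symmetric under inversion.\<close>

lemma stab_inverse: "c \<in> stab \<Longrightarrow> inverse c \<in> stab"
  using reduced_basis_exists stab_gaps by (fastforce simp: power_inverse)

lemma dilation_auto:
  assumes "c \<in> stab"
  shows "restrict (\<lambda>f. pcompose f [:0, c:]) A \<in> alg_auto A"
proof -
  have c: "c \<noteq> 0" "\<And>f. f \<in> A \<Longrightarrow> pcompose f [:0, c:] \<in> A"
    "\<And>f. f \<in> A \<Longrightarrow> pcompose f [:0, inverse c:] \<in> A"
    using assms stab_inverse[OF assms] by (auto simp: stab_def)
  have "bij_betw (\<lambda>f. pcompose f [:0, c:]) A A"
    using c by (intro bij_betw_byWitness[of _ "\<lambda>f. pcompose f [:0, inverse c:]"])
      (auto simp: pcompose_dilation_dilation)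
  hence "bij_betw (restrict (\<lambda>f. pcompose f [:0, c:]) A) A A"
    by (simp add: bij_betw_restrict_eq)
  thus ?thesis
    by (simp add: alg_auto_def Bij_def one_mem add_mem mult_mem smult_mem pcompose_1 pcompose_add
        pcompose_mult pcompose_smult)
qed

end

section \<open>Every automorphism is a dilation\<close>

locale conductor_subalgebra_alg_closed = conductor_subalgebra A m
  for A :: "'a::alg_closed_field poly set" and m :: nat
begin

text \<open>With \<open>u = \<phi>(x\<^sup>m)\<close> and \<open>v = \<phi>(x\<^bsup>m+1\<^esup>)\<close> the only candidate for the image of \<open>x\<close> is \<open>w = v/u\<close>;
  it is a polynomial because \<open>v\<^sup>m = u\<^bsup>m+1\<^esup>\<close>.\<close>

lemma alg_auto_eq_pcompose:
  assumes \<phi>: "\<phi> \<in> alg_auto A"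
  obtains w where "\<And>f. f \<in> A \<Longrightarrow> \<phi> f = pcompose f w"
    "\<And>h. \<phi> (monom 1 m * h) = w ^ m * pcompose h w"
proof -
  have bij: "bij_betw \<phi> A A" and one: "\<phi> 1 = 1"
    and add: "\<And>f g. f \<in> A \<Longrightarrow> g \<in> A \<Longrightarrow> \<phi> (f + g) = \<phi> f + \<phi> g"
    and mult: "\<And>f g. f \<in> A \<Longrightarrow> g \<in> A \<Longrightarrow> \<phi> (f * g) = \<phi> f * \<phi> g"
    and smult: "\<And>c f. f \<in> A \<Longrightarrow> \<phi> (smult c f) = smult c (\<phi> f)"
    using \<phi> by (auto simp: alg_auto_def Bij_def)
  have zero: "\<phi> 0 = 0" using smult[OF one_mem, of 0] by simp
  have pow: "\<phi> (f ^ n) = \<phi> f ^ n" if "f \<in> A" for f n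
    by (induction n) (auto simp: one mult power_mem that)
  have mem: "monom 1 k \<in> A" if "k \<ge> m" for k
    using that by (intro high_mem) auto
  define u v where "u = \<phi> (monom 1 m)" and "v = \<phi> (monom 1 (Suc m))"
  have "u \<noteq> 0"
  proof
    assume "u = 0"
    hence "monom 1 m = (0 :: 'a poly)"
      using inj_onD[of \<phi> A "monom 1 m" 0] bij zero zero_mem mem[of m] by (simp add: u_def bij_betw_def)
    thus False by simp
  qed
  \<comment> \<open>Both sides are the image of \<open>x^(m(m+1))\<close>.\<close>
  have uv: "v ^ m = u ^ Suc m"
    unfolding u_def v_def pow[OF mem[OF order_refl], symmetric] pow[OF mem[OF le_SucI[OF order_refl]], symmetric]
    by (simp only: monom_power power_one mult.commute[of m])
  hence "u ^ m dvd v ^ m" by simp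
  hence "u dvd v" using m_ge_2 by (intro power_dvd_power_imp_dvd[of u m v]) auto
  then obtain w where w: "v = u * w" by (elim dvdE)
  have "u ^ m * w ^ m = u ^ m * u" using uv by (simp add: w power_mult_distrib mult.commute)
  hence uw: "u = w ^ m" using \<open>u \<noteq> 0\<close> by simp
  have "w \<noteq> 0" using \<open>u \<noteq> 0\<close> uw m_ge_2 by (auto simp: power_0_left)
  \<comment> \<open>Apply \<open>\<phi>\<close> to \<open>x^(m+k) (x^m)^k = x^m (x^(m+1))^k\<close>,
    whose factors all lie in \<open>A\<close>, and cancel \<open>u ^ k\<close>.\<close>
  have mon: "\<phi> (monom 1 (m + k)) = w ^ (m + k)" for k
  proof -
    have "\<phi> (monom 1 (m + k)) * u ^ k = \<phi> (monom 1 (m + k) * monom 1 m ^ k)"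
      by (simp add: mult pow mem power_mem u_def)
    also have "monom 1 (m + k) * monom 1 m ^ k = monom (1 :: 'a) m * monom 1 (Suc m) ^ k"
      by (simp add: monom_power mult_monom algebra_simps)
    also have "\<phi> \<dots> = u * v ^ k"
      by (simp add: mult pow mem power_mem u_def v_def)
    also have "\<dots> = w ^ (m + k) * u ^ k"
      by (simp add: w uw power_mult_distrib power_add algebra_simps)
    finally show ?thesis using \<open>u \<noteq> 0\<close> by simp
  qed
  have high: "\<phi> (monom 1 (m + k) * h) = w ^ (m + k) * pcompose h w" for k h
  proof (induction h arbitrary: k)
    case 0
    show ?case by (simp add: zero)
  next
    case (pCons a h)
    have mem': "monom 1 (m + k) * h \<in> A" for k h
      by (intro high_mem) (simp add: coeff_monom_mult)
    have "monom 1 (m + k) * pCons a h = smult a (monom 1 (m + k)) + monom 1 (m + Suc k) * h"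
      by (simp add: monom_Suc algebra_simps)
    hence "\<phi> (monom 1 (m + k) * pCons a h) = smult a (w ^ (m + k)) + w ^ (m + Suc k) * pcompose h w"
      by (simp only: add smult smult_mem mem mem' mon pCons.IH le_add1)
    thus ?case by (simp add: pcompose_pCons algebra_simps)
  qed
  \<comment> \<open>Multiplication by \<open>x^m\<close> moves \<open>f\<close> into the conductor,
    where \<open>\<phi>\<close> is known.\<close>
  have "\<phi> f = pcompose f w" if "f \<in> A" for f
  proof -
    have "w ^ m * \<phi> f = \<phi> (monom 1 m * f)" using that mult[OF mem[of m] that] mon[of 0] by simp
    also have "\<dots> = w ^ m * pcompose f w" using high[of 0 f] by simp
    finally show ?thesis using \<open>w \<noteq> 0\<close> by simp
  qed
  thus ?thesis using high[of 0] by (intro that[of w]) auto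
qed

text \<open>If \<open>b \<noteq> 0\<close>, then \<open>b h = w h - a x h\<close> with \<open>w = b + a x\<close> brings \<open>x\<^bsup>m-1\<^esup> w\<^sup>j\<close> into the conductor
  successively for \<open>j = m, \<dots>, 0\<close>.\<close>

lemma conductor_linear_power:
  assumes "a \<noteq> 0" and h: "\<And>h. [:b, a:] ^ m * h \<in> A"
  shows "b = 0"
proof (rule ccontr)
  assume "b \<noteq> 0"
  let ?w = "[:b, a:]"
  have "\<forall>h. monom 1 (m - 1) * ?w ^ (m - j) * h \<in> A" if "j \<le> m" for j
    using that
  proof (induction j)
    case 0
    show ?case using h by (auto simp: mult.assoc mult.left_commute[of _ "?w ^ m"])
  next
    case (Suc j)
    have w: "?w ^ (m - j) = ?w * ?w ^ (m - Suc j)"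
      using Suc.prems by (metis Suc_diff_le diff_Suc_Suc power_Suc)
    have x: "monom 1 m = [:0, 1:] * monom (1 :: 'a) (m - 1)"
      using m_ge_2 by (cases m) (auto simp: monom_Suc)
    show ?case
    proof
      fix h
      let ?p = "monom 1 (m - 1) * ?w ^ (m - Suc j) * h"
      have "smult b ?p = monom 1 (m - 1) * ?w ^ (m - j) * h - monom 1 m * (smult a (?w ^ (m - Suc j) * h))"
        unfolding w x by (simp add: algebra_simps)
      also have "\<dots> \<in> A" using Suc by (intro diff_mem monom_mult_mem) auto
      finally have "smult (1 / b) (smult b ?p) \<in> A" by (rule smult_mem)
      thus "?p \<in> A" using \<open>b \<noteq> 0\<close> by simp
    qed
  qed
  from this[of m] have "\<forall>h. monom 1 (m - 1) * h \<in> A" by simp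
  from this[rule_format, of 1] show False using monom_notin by simp
qed

text \<open>By surjectivity, the degree of \<open>w\<close> divides the degree of every element of
  \<open>A\<close>, in particular \<open>m\<close> and \<open>m + 1\<close>. So \<open>w\<close> is
  linear, and its constant term vanishes because \<open>w^m K[x]\<close>, the image of the
  conductor, lies in \<open>A\<close>.\<close>

lemma alg_auto_eq_dilation:
  assumes \<phi>: "\<phi> \<in> alg_auto A"
  obtains c where "c \<in> stab" "\<phi> = restrict (\<lambda>f. pcompose f [:0, c:]) A"
proof -
  obtain w where w: "\<And>f. f \<in> A \<Longrightarrow> \<phi> f = pcompose f w"
    "\<And>h. \<phi> (monom 1 m * h) = w ^ m * pcompose h w"
    using alg_auto_eq_pcompose[OF \<phi>] by blast
  have ext: "\<phi> \<in> extensional A" and im: "\<phi> ` A = A"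
    using \<phi> by (auto simp: alg_auto_def Bij_def bij_betw_def)
  have dvd: "degree w dvd degree f" if f: "f \<in> A" for f
  proof -
    from f im obtain g where "g \<in> A" "f = \<phi> g" by blast
    thus ?thesis by (simp add: w degree_pcompose)
  qed
  have "degree w dvd m" "degree w dvd Suc m"
    using dvd[OF high_mem[of "monom 1 m"]] dvd[OF high_mem[of "monom 1 (Suc m)"]]
    by (simp_all add: degree_monom_eq)
  hence "degree w = 1" by (metis dvd_add_right_iff Suc_eq_plus1 nat_dvd_1_iff_1)
  then obtain a b where ab: "w = [:b, a:]" "a \<noteq> 0"
    using degree1_coeffs[of w] by metis
  have "w ^ m * h \<in> A" for h
  proof -
    \<comment> \<open>The inverse linear substitution gives a preimage of \<open>w ^ m * h\<close>
      in the conductor.\<close>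
    have "pcompose [:- b / a, 1 / a:] w = [:0, 1:]"
      using ab by (simp add: pcompose_pCons)
    hence "w ^ m * h = \<phi> (monom 1 m * pcompose h [:- b / a, 1 / a:])"
      by (simp add: w(2) flip: pcompose_assoc)
    thus ?thesis using im monom_mult_mem by blast
  qed
  hence "b = 0" using ab conductor_linear_power by blast
  have "a \<in> stab" using ab im w \<open>b = 0\<close> by (auto simp: stab_def)
  moreover have "\<phi> = restrict (\<lambda>f. pcompose f [:0, a:]) A"
    using ext w ab \<open>b = 0\<close> by (intro extensionalityI[of _ A]) auto
  ultimately show ?thesis by (rule that)
qed

lemma bij_betw_stab_alg_auto:
  "bij_betw (\<lambda>c. restrict (\<lambda>f. pcompose f [:0, c:]) A) stab (alg_auto A)"
proof -
  have "c = d" if "c \<in> stab" "d \<in> stab"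
    and eq: "restrict (\<lambda>f. pcompose f [:0, c:]) A = restrict (\<lambda>f. pcompose f [:0, d:]) A" for c d
  proof -
    \<comment> \<open>The exponents \<open>m\<close> and \<open>m + 1\<close> suffice to recover a
      nonzero \<open>c\<close> as a quotient.\<close>
    have "c ^ k = d ^ k" if "k \<ge> m" for k
    proof -
      have "monom 1 k \<in> A" using that by (intro high_mem) auto
      hence "pcompose (monom 1 k) [:0, c:] = pcompose (monom 1 k) [:0, d:]"
        using fun_cong[OF eq, of "monom 1 k"] by simp
      hence "coeff (pcompose (monom 1 k) [:0, c:]) k = coeff (pcompose (monom 1 k) [:0, d:]) k" by simp
      thus ?thesis by (simp add: coeff_pcompose_linear)
    qed
    from this[of m] this[of "Suc m"] that show "c = d" by (simp add: stab_def)
  qed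
  thus ?thesis
    using dilation_auto alg_auto_eq_dilation unfolding bij_betw_def inj_on_def by blast
qed

lemma finite_auto_iff: "finite (alg_auto A) \<longleftrightarrow> finite stab"
  and card_auto: "card (alg_auto A) = card stab"
  using bij_betw_finite[OF bij_betw_stab_alg_auto] bij_betw_same_card[OF bij_betw_stab_alg_auto]
  by auto

end

section \<open>Group orders and the set \<open>B_set m\<close>\<close>

lemma S_set_iff:
  "\<Gamma> \<in> S_set m \<longleftrightarrow> \<Gamma> = {} \<or> \<Gamma> \<subseteq> {2..m-2} \<and> (\<forall>a\<in>\<Gamma>. \<forall>b\<in>\<Gamma>. a + b \<in> \<Gamma> \<or> a + b \<ge> m)"
  unfolding S_set_def by blast

lemma notin_B_set_iff:
  assumes "1 \<le> l" "l \<le> m - 1"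
  shows "l \<notin> B_set m \<longleftrightarrow> (\<exists>\<Gamma>\<in>S_set m. \<exists>a\<in>\<Gamma>. a + l \<notin> \<Gamma> \<and> a + l < m)"
  using assms unfolding B_set_def by (auto simp: add.commute image_subset_iff not_le)

text \<open>Walk from \<open>a\<close> to \<open>a + n\<close> in steps of length \<open>l\<close>:
  the walk starts in \<open>\<Gamma>\<close> and ends outside it, below \<open>m\<close>, so some
  single step leaves \<open>\<Gamma>\<close>.\<close>

lemma divisor_notin_B_set:
  assumes "1 \<le> n" "n \<le> m - 1" "n \<notin> B_set m" "l dvd n"
  shows "l \<notin> B_set m"
proof -
  from assms obtain q where q: "n = l * q" by (elim dvdE)
  have l: "1 \<le> l" "l \<le> m - 1" using assms dvd_imp_le[of l n] by (auto intro: Suc_leI Nat.gr0I)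
  obtain \<Gamma> a where \<Gamma>: "\<Gamma> \<in> S_set m" "a \<in> \<Gamma>" "a + l * q \<notin> \<Gamma>" "a + l * q < m"
    using notin_B_set_iff[OF assms(1,2)] assms(3) q by blast
  have "\<exists>b\<in>\<Gamma>. b + l \<notin> \<Gamma> \<and> b + l < m"
    using \<Gamma>(2-)
  proof (induction q arbitrary: a)
    case (Suc q)
    show ?case
    proof (cases "a + l \<in> \<Gamma>")
      case True
      with Suc show ?thesis by (intro Suc.IH[of "a + l"]) (auto simp: algebra_simps)
    qed (use Suc in auto)
  qed simp
  thus ?thesis using notin_B_set_iff[OF l] \<Gamma>(1) by blast
qed

lemma card_auto_bounds:
  fixes A :: "'a::alg_closed_field poly set"
  assumes "A \<in> subalgebras m" "finite (alg_auto A)"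
  defines "l \<equiv> card (alg_auto A)"
  shows "1 \<le> l" "l \<le> m - 1" "\<not> CHAR('a) dvd l" "l \<notin> B_set m"
proof -
  interpret conductor_subalgebra_alg_closed A m
    by standard (rule assms)
  obtain F where F: "reduced_basis F" using reduced_basis_exists by blast
  define D where "D = gaps F"
  have fin: "finite {c :: 'a. c \<noteq> 0 \<and> (\<forall>n\<in>D. c ^ n = 1)}"
    using assms(2) by (simp add: finite_auto_iff stab_gaps[OF F] D_def)
  \<comment> \<open>Without gaps every nonzero \<open>c\<close> would give an automorphism,
    contradicting finiteness.\<close>
  hence "D \<noteq> {}" using infinite_nonzero_alg_closed by force
  then obtain n where n: "n \<in> D" by blast
  have wit: "\<exists>k\<in>ords. k > 0 \<and> n > 0 \<and> k + n \<notin> ords \<and> k + n < m" if "n \<in> D" for n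
    using gaps_witness[OF F, of n] that by (auto simp: D_def)
  have D: "D \<subseteq> {1..m-1}" using wit by fastforce
  have "finite D" using D finite_subset by blast
  define d where "d = Gcd D"
  have dvd: "d dvd n" using n by (simp add: d_def)
  have n1: "1 \<le> n" "n \<le> m - 1" using n D by auto
  have "d > 0" using dvd n1 by (auto intro: Nat.gr0I)
  have "stab = {c. c ^ d = 1}"
  proof -
    have "c ^ k = 1" if "c ^ d = 1" "k \<in> D" for c :: 'a and k
    proof -
      have "d dvd k" using that by (simp add: d_def)
      thus ?thesis using that by (auto elim!: dvdE simp: power_mult)
    qed
    moreover have "c ^ d = 1" if "\<forall>k\<in>D. c ^ k = 1" for c :: 'a
      unfolding d_def using that \<open>finite D\<close> by (intro power_Gcd_eq_1) auto
    moreover have "c \<noteq> 0" if "c ^ d = 1" for c :: 'a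
      using that \<open>d > 0\<close> by (auto simp: power_0_left)
    ultimately show ?thesis unfolding stab_gaps[OF F] D_def[symmetric] by blast
  qed
  moreover obtain e where e: "e dvd d" "\<not> CHAR('a) dvd e" "{c :: 'a. c ^ d = 1} = {c. c ^ e = 1}"
    using roots_of_unity_coprime_part[OF \<open>d > 0\<close>] by blast
  moreover have "e > 0" using e \<open>d > 0\<close> by (auto intro: Nat.gr0I)
  ultimately have le: "l = e" using card_roots_of_unity[of e] by (simp add: l_def card_auto)
  hence ldvd: "l dvd n" using e dvd dvd_trans by blast
  show "1 \<le> l" "\<not> CHAR('a) dvd l" using le e \<open>e > 0\<close> by auto
  show "l \<le> m - 1" using ldvd n1 dvd_imp_le[of l n] by linarith
  \<comment> \<open>The value semigroup of \<open>A\<close> itself witnesses that \<open>n\<close>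
    is outside \<open>B_set m\<close>; this passes to the divisor \<open>l\<close>.\<close>
  obtain k where "k \<in> ords \<inter> {1..m-1}" "k + n \<notin> ords \<inter> {1..m-1}" "k + n < m"
    using wit[OF n] by fastforce
  hence "n \<notin> B_set m"
    using notin_B_set_iff[OF n1] ords_S_set by blast
  thus "l \<notin> B_set m" using divisor_notin_B_set n1 ldvd by blast
qed

text \<open>Taking for \<open>a\<close> the largest element of \<open>\<Gamma>\<close> whose translate by \<open>l\<close> is not in \<open>\<Gamma> \<union> [m,\<infinity>)\<close>
  makes the span of \<open>1\<close>, \<open>x\<^sup>a + x\<^bsup>a+l\<^esup>\<close>, the \<open>x\<^sup>b\<close> with \<open>b \<in> \<Gamma>\<close>, \<open>b > a\<close>, and
  \<open>x\<^sup>m K[x]\<close> closed under multiplication: \<open>b + l\<close> stays in \<open>\<Gamma> \<union> [m,\<infinity>)\<close> for every such \<open>b\<close>.\<close>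

lemma subalgebra_with_auto_order:
  assumes l: "1 \<le> l" "l \<le> m - 1" "\<not> CHAR('a::alg_closed_field) dvd l" "l \<notin> B_set m"
  shows "\<exists>A :: 'a poly set. A \<in> subalgebras m \<and> finite (alg_auto A) \<and> card (alg_auto A) = l"
proof -
  obtain \<Gamma> where \<Gamma>: "\<Gamma> \<in> S_set m" "\<exists>a\<in>\<Gamma>. a + l \<notin> \<Gamma> \<and> a + l < m"
    using notin_B_set_iff[OF l(1,2)] l(4) by blast
  hence sub: "\<Gamma> \<subseteq> {2..m-2}" and add: "\<And>a b. a \<in> \<Gamma> \<Longrightarrow> b \<in> \<Gamma> \<Longrightarrow> a + b \<in> \<Gamma> \<or> a + b \<ge> m"
    by (auto simp: S_set_iff)
  define S where "S = {a \<in> \<Gamma>. a + l \<notin> \<Gamma> \<and> a + l < m}"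
  define a where "a = Max S"
  have "finite S" using sub finite_subset[of \<Gamma>] by (auto simp: S_def)
  moreover have "S \<noteq> {}" using \<Gamma> by (auto simp: S_def)
  ultimately have "a \<in> S" and max: "\<And>b. b \<in> S \<Longrightarrow> b \<le> a" by (auto simp: a_def)
  hence a: "a \<in> \<Gamma>" "a + l \<notin> \<Gamma>" "a + l < m" "a \<ge> 2" using sub by (auto simp: S_def)
  define T where "T = {b. b > a \<and> b \<in> \<Gamma> \<or> b \<ge> m}"
  \<comment> \<open>An element of \<open>\<Gamma>\<close> above \<open>a\<close> violating this
    would contradict the maximality of \<open>a\<close>.\<close>
  have T_l: "b + l \<in> T" if "b \<in> T" for b
    using max[of b] that unfolding T_def S_def by (smt (verit) mem_Collect_eq not_less trans_le_add1 trans_less_add1)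
  have T_add: "b + c \<in> T" if "b \<in> insert a T" "c \<in> insert a T" for b c
    using add[of b c] a sub that by (auto simp: T_def)
  have notT: "0 \<notin> T" "a \<notin> T" "a + l \<notin> T" using a l by (auto simp: T_def)
  have m: "m - 1 \<notin> T" "a < m - 1" using sub a l by (fastforce simp: T_def)+
  define A :: "'a poly set" where
    "A = {f. \<forall>i. i \<notin> insert 0 (insert a T) \<longrightarrow> coeff f i = (if i = a + l then coeff f a else 0)}"
  have AI: "f \<in> A" if "coeff f (a + l) = coeff f a"
      "\<And>i. coeff f i \<noteq> 0 \<Longrightarrow> i \<in> insert 0 (insert a (insert (a + l) T))" for f
    unfolding A_def using that by auto
  have AD1: "coeff f (a + l) = coeff f a" if "f \<in> A" for f
    using that a l notT by (auto simp: A_def)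
  have AD2: "i \<in> insert 0 (insert a (insert (a + l) T))" if "f \<in> A" "coeff f i \<noteq> 0" for f i
    using that unfolding A_def by (metis (mono_tags, lifting) insertCI insertE mem_Collect_eq)
  have mult: "f * g \<in> A" if f: "f \<in> A" and g: "g \<in> A" for f g
  proof -
    \<comment> \<open>With the constant terms removed, all exponents of the product lie in
      \<open>T\<close>, where membership in \<open>A\<close> imposes no condition.\<close>
    define f0 g0 where "f0 = f - [:coeff f 0:]" and "g0 = g - [:coeff g 0:]"
    have sup: "i \<in> insert a (insert (a + l) T)" if "coeff f0 i \<noteq> 0 \<or> coeff g0 i \<noteq> 0" for i
      using that AD2[OF f, of i] AD2[OF g, of i] by (auto simp: f0_def g0_def coeff_pCons split: nat.splits)
    have sum_T: "i + j \<in> T" if "i \<in> insert a (insert (a + l) T)" "j \<in> insert a (insert (a + l) T)" for i j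
    proof -
      have aa: "a + a \<in> T" using T_add by simp
      have ab: "a + b \<in> T" "a + l + b \<in> T" "b + a \<in> T" "b + (a + l) \<in> T" if "b \<in> T" for b
        using T_add[of a b] T_l[of "a + b"] that by (simp_all add: ac_simps)
      have al: "a + (a + l) \<in> T" "a + l + a \<in> T" "a + l + (a + l) \<in> T"
        using T_l[OF aa] T_l[OF T_l[OF aa]] by (simp_all add: ac_simps)
      have "i = a \<or> i = a + l \<or> i \<in> T" "j = a \<or> j = a + l \<or> j \<in> T" using that by auto
      thus ?thesis by (elim disjE) (use aa ab al T_add[of i j] in \<open>simp_all only: insertI2\<close>)
    qed
    have supp: "i \<in> T" if "coeff (f0 * g0) i \<noteq> 0" for i
    proof -
      from that obtain k where "k \<le> i" "coeff f0 k * coeff g0 (i - k) \<noteq> 0"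
        unfolding coeff_mult by (meson atMost_iff sum.not_neutral_contains_not_neutral)
      thus ?thesis using sup[of k] sup[of "i - k"] sum_T[of k "i - k"] by auto
    qed
    have fg: "f * g = f0 * g0 + smult (coeff f 0) g + smult (coeff g 0) f - [:coeff f 0 * coeff g 0:]"
      by (simp add: f0_def g0_def algebra_simps)
    have z: "coeff (f0 * g0) i = 0" if "i \<notin> T" for i using supp that by blast
    have c: "coeff (f * g) i = coeff (f0 * g0) i + coeff f 0 * coeff g i + coeff g 0 * coeff f i"
      if "i \<noteq> 0" for i
      using that unfolding fg by (simp add: coeff_pCons split: nat.splits)
    show ?thesis
      using f g a l notT unfolding A_def by (auto simp: c z)
  qed
  have "A \<in> subalgebras m"
  proof -
    have "1 \<in> A" using a by (intro AI) (auto split: if_splits)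
    moreover have "monom 1 m * h \<in> A" for h
      using a by (intro AI) (auto simp: coeff_monom_mult T_def split: if_splits)
    moreover have "monom 1 (m - 1) \<notin> A"
    proof
      assume *: "monom 1 (m - 1) \<in> A"
      \<comment> \<open>No other exponent allowed in \<open>A\<close> equals \<open>m - 1\<close>;
        but then the coefficients at \<open>a\<close> and \<open>a + l\<close> would have to agree,
        and they are 0 and 1.\<close>
      have "m - 1 = a + l" using AD2[OF *, of "m - 1"] m by auto
      thus False using AD1[OF *] m by auto
    qed
    moreover have "f + g \<in> A" "smult c f \<in> A" if "f \<in> A" "g \<in> A" for f g c
      using that by (auto simp: A_def)
    ultimately show ?thesis using mult by (simp add: subalgebras_def is_subalgebra_def image_subset_iff)
  qed
  interpret conductor_subalgebra_alg_closed A m by standard fact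
  \<comment> \<open>Dilating this binomial within \<open>A\<close> must keep its two coefficients
    equal, which forces \<open>c ^ l = 1\<close>.\<close>
  define f :: "'a poly" where "f = monom 1 a + monom 1 (a + l)"
  have "f \<in> A" using a l by (intro AI) (auto simp: f_def split: if_splits)
  have "stab = {c. c ^ l = 1}"
  proof (intro equalityI subsetI CollectI)
    fix c assume "c \<in> stab"
    hence c: "c \<noteq> 0" "pcompose f [:0, c:] \<in> A" using \<open>f \<in> A\<close> by (auto simp: stab_def)
    hence "c ^ (a + l) = c ^ a"
      using AD1[OF c(2)] l by (simp add: coeff_pcompose_linear f_def)
    thus "c ^ l = 1" using c by (simp add: power_add)
  next
    fix c :: 'a assume c: "c \<in> {c. c ^ l = 1}"
    hence "pcompose g [:0, c:] \<in> A" if "g \<in> A" for g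
      using AD1[OF that] AD2[OF that]
      by (intro AI) (auto simp: coeff_pcompose_linear power_add)
    moreover have "c \<noteq> 0" using c l by (auto simp: power_0_left)
    ultimately show "c \<in> stab" by (simp add: stab_def)
  qed
  hence "card stab = l" using card_roots_of_unity[of l] l by simp
  \<comment> \<open>An infinite set has \<open>card\<close> 0, whereas \<open>l\<close> is
    positive.\<close>
  moreover from this have "finite stab" using l by (intro card_ge_0_finite) auto
  ultimately show ?thesis using \<open>A \<in> subalgebras m\<close> finite_auto_iff card_auto by auto
qed

text \<open>Uniform in the characteristic: \<open>0 dvd l\<close> means \<open>l = 0\<close>, so in
  characteristic 0 the divisibility condition excludes no positive \<open>l\<close>.\<close>

lemma aut_orders_eq:
  "aut_orders TYPE('a::alg_closed_field) m = {l. 1 \<le> l \<and> l \<le> m - 1 \<and> \<not> CHAR('a) dvd l} - B_set m"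
proof (intro equalityI subsetI)
  fix l assume "l \<in> aut_orders TYPE('a) m"
  then obtain A :: "'a poly set" where "A \<in> subalgebras m" "finite (alg_auto A)" "l = card (alg_auto A)"
    by (auto simp: aut_orders_def AutAlg_def)
  thus "l \<in> {l. 1 \<le> l \<and> l \<le> m - 1 \<and> \<not> CHAR('a) dvd l} - B_set m"
    using card_auto_bounds by blast
next
  fix l assume "l \<in> {l. 1 \<le> l \<and> l \<le> m - 1 \<and> \<not> CHAR('a) dvd l} - B_set m"
  hence "\<exists>A :: 'a poly set. A \<in> subalgebras m \<and> finite (alg_auto A) \<and> card (alg_auto A) = l"
    using subalgebra_with_auto_order by blast
  thus "l \<in> aut_orders TYPE('a) m"
    by (auto simp: aut_orders_def AutAlg_def)
qed

text \<open>A number prime to \<open>p\<close> is its own \<open>p\<close>-co-prime part. Conversely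
  that part divides \<open>l\<close>, and the complement of \<open>B_set m\<close> is closed under
  divisors.\<close>

lemma coprime_part_image:
  assumes "prime p"
  shows "{l. 1 \<le> l \<and> l \<le> m - 1 \<and> \<not> p dvd l} - B_set m
    = {coprime_part p l | l. l \<in> {1..m-1} - B_set m}"
proof (intro equalityI subsetI)
  fix l assume l: "l \<in> {l. 1 \<le> l \<and> l \<le> m - 1 \<and> \<not> p dvd l} - B_set m"
  hence "coprime_part p l = l" using coprime_part_iff[OF assms, of l l] by (auto intro: exI[of _ 0])
  with l show "l \<in> {coprime_part p l | l. l \<in> {1..m-1} - B_set m}" by force
next
  fix q assume "q \<in> {coprime_part p l | l. l \<in> {1..m-1} - B_set m}"
  then obtain l where l: "1 \<le> l" "l \<le> m - 1" "l \<notin> B_set m" and q: "q = coprime_part p l" by auto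
  from q coprime_part_iff[OF assms l(1), of q] obtain k where k: "l = p ^ k * q" "\<not> p dvd q" by auto
  hence "q dvd l" by simp
  moreover have "q \<ge> 1" using k by (cases q) auto
  ultimately show "q \<in> {l. 1 \<le> l \<and> l \<le> m - 1 \<and> \<not> p dvd l} - B_set m"
    using l k(2) divisor_notin_B_set[OF l] dvd_imp_le[of q l] by auto
qed

theorem corollary3p9:
  fixes m :: nat
  assumes "m \<ge> 4"
  shows "(CHAR('a::alg_closed_field) = 0 \<longrightarrow>
            aut_orders TYPE('a) m = {1..m-1} - B_set m) \<and>
         (\<forall>p. CHAR('a) = p \<and> p > 0 \<longrightarrow>
            aut_orders TYPE('a) m = {l. 1 \<le> l \<and> l \<le> m - 1 \<and> \<not> p dvd l} - B_set m \<and>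
            {l. 1 \<le> l \<and> l \<le> m - 1 \<and> \<not> p dvd l} - B_set m
              = {coprime_part p l | l. l \<in> {1..m-1} - B_set m})"
proof (intro conjI impI allI)
  assume "CHAR('a) = 0"
  thus "aut_orders TYPE('a) m = {1..m-1} - B_set m"
    by (auto simp: aut_orders_eq)
next
  fix p assume p: "CHAR('a) = p \<and> p > 0"
  thus "aut_orders TYPE('a) m = {l. 1 \<le> l \<and> l \<le> m - 1 \<and> \<not> p dvd l} - B_set m"
    by (simp add: aut_orders_eq)
  have "prime p" using p prime_CHAR_semidom[where ?'a = 'a] by auto
  thus "{l. 1 \<le> l \<and> l \<le> m - 1 \<and> \<not> p dvd l} - B_set m
      = {coprime_part p l | l. l \<in> {1..m-1} - B_set m}"
    by (rule coprime_part_image)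
qed

end
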